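(* Let $L:\mathbb{R}^n\times\mathbb{R}^m\to\mathbb{R}$ be twice differentiable and $\rho$-weakly convex-weakly concave, and let $\eta>0$ with $\eta>\rho$. If $L$ is $\alpha$-interaction dominant in $x$ (with respect to $\eta$) with $\alpha\in\mathbb{R}$, then the saddle envelope $L_\eta$ is smooth and weakly convex with respect to $x$, in the sense that $$(\eta^{-1}+\alpha^{-1})^{-1}I\preceq\nabla^2_{xx}L_\eta(z)\preceq\eta I ,$$ and if $L$ is $\alpha$-interaction dominant in $y$ (with respect to $\eta$) with $\alpha\in\mathbb{R}$, then the saddle envelope is smooth and weakly concave with respect to $y$, in the sense that $$(\eta^{-1}+\alpha^{-1})^{-1}I\preceq-\nabla^2_{yy}L_\eta(z)\preceq\eta I ,$$ these bounds holding for all $z\in\mathbb{R}^n\times\mathbb{R}^m$.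
   Context: A twice differentiable $L$ is $\rho$-weakly convex-weakly concave ($\rho\in\mathbb{R}$) if $\nabla^2_{xx}L(z)\succeq-\rho I$ and $-\nabla^2_{yy}L(z)\succeq-\rho I$ for all $z=(x,y)$. For $\eta>\rho$, the saddle envelope is $L_\eta(x,y)=\min_{u\in\mathbb{R}^n}\max_{v\in\mathbb{R}^m}L(u,v)+\frac{\eta}{2}\|u-x\|^2-\frac{\eta}{2}\|v-y\|^2$. $L$ is $\alpha$-interaction dominant in $x$ if for all $z$ $$\nabla^2_{xx}L(z)+\nabla^2_{xy}L(z)(\eta I-\nabla^2_{yy}L(z))^{-1}\nabla^2_{yx}L(z)\succeq\alpha I,$$ and $\alpha$-interaction dominant in $y$ if for all $z$ $$-\nabla^2_{yy}L(z)+\nabla^2_{yx}L(z)(\eta I+\nabla^2_{xx}L(z))^{-1}\nabla^2_{xy}L(z)\succeq\alpha I.$$ Convention: $(\eta^{-1}+\alpha^{-1})^{-1}$ is read as $\eta-\eta^2/(\eta+\alpha)=\eta\alpha/(\eta+\alpha)$, so it equals $0$ if $\alpha=0$.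
   Formalization: The formal theorem assumes α > −η instead of any real α: for α = −η the bound is undefined, and for α < −η it exceeds η, so the claim fails (e.g. L = 0, ρ = 0, η = 1, α = −2 would give 2I ⪯ 0). *)

theory Defs
  imports "HOL-Analysis.Analysis"
begin

definition gradient :: "('a::euclidean_space \<Rightarrow> real) \<Rightarrow> 'a \<Rightarrow> 'a" where
  "gradient f z = (THE D. GDERIV f z :> D)"

definition twice_differentiable :: "('a::euclidean_space \<Rightarrow> real) \<Rightarrow> bool" where
  "twice_differentiable f \<longleftrightarrow>
     (\<forall>z. f differentiable (at z)) \<and> (\<forall>z. gradient f differentiable (at z))"

text \<open>
  The four blocks of the Hessian of a function of \<open>z = (x, y)\<close>, where the Hessian is the
  Frechet derivative of the gradient. Block \<open>xy\<close> has the rows indexed by the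
  coordinates of \<open>x\<close> and the columns by those of \<open>y\<close>; block \<open>yx\<close> the other way round.
  The blocks are meaningful only if the function is twice differentiable.
\<close>

definition hess_xx :: "((real ^ 'n) \<times> (real ^ 'm) \<Rightarrow> real) \<Rightarrow> (real ^ 'n) \<times> (real ^ 'm) \<Rightarrow> real ^ 'n ^ 'n" where
  "hess_xx L z = matrix (\<lambda>h. fst (frechet_derivative (gradient L) (at z) (h, 0)))"

definition hess_xy :: "((real ^ 'n) \<times> (real ^ 'm) \<Rightarrow> real) \<Rightarrow> (real ^ 'n) \<times> (real ^ 'm) \<Rightarrow> real ^ 'm ^ 'n" where
  "hess_xy L z = matrix (\<lambda>h. fst (frechet_derivative (gradient L) (at z) (0, h)))"

definition hess_yx :: "((real ^ 'n) \<times> (real ^ 'm) \<Rightarrow> real) \<Rightarrow> (real ^ 'n) \<times> (real ^ 'm) \<Rightarrow> real ^ 'n ^ 'm" where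
  "hess_yx L z = matrix (\<lambda>h. snd (frechet_derivative (gradient L) (at z) (h, 0)))"

definition hess_yy :: "((real ^ 'n) \<times> (real ^ 'm) \<Rightarrow> real) \<Rightarrow> (real ^ 'n) \<times> (real ^ 'm) \<Rightarrow> real ^ 'm ^ 'm" where
  "hess_yy L z = matrix (\<lambda>h. snd (frechet_derivative (gradient L) (at z) (0, h)))"

definition positive_semidefinite :: "real ^ 'n ^ 'n \<Rightarrow> bool" where
  "positive_semidefinite A \<longleftrightarrow> transpose A = A \<and> (\<forall>v. 0 \<le> v \<bullet> (A *v v))"

definition loewner_le :: "real ^ 'n ^ 'n \<Rightarrow> real ^ 'n ^ 'n \<Rightarrow> bool" (infix "\<preceq>" 50) where
  "A \<preceq> B \<longleftrightarrow> positive_semidefinite (B - A)"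

text \<open>In the following, \<open>mat c\<close> is the scalar matrix \<open>c I\<close>.\<close>

definition weakly_convex_weakly_concave ::
    "real \<Rightarrow> ((real ^ 'n) \<times> (real ^ 'm) \<Rightarrow> real) \<Rightarrow> bool" where
  "weakly_convex_weakly_concave \<rho> L \<longleftrightarrow>
     (\<forall>z. mat (- \<rho>) \<preceq> hess_xx L z \<and> mat (- \<rho>) \<preceq> - hess_yy L z)"

definition interaction_dominant_x ::
    "real \<Rightarrow> real \<Rightarrow> ((real ^ 'n) \<times> (real ^ 'm) \<Rightarrow> real) \<Rightarrow> bool" where
  "interaction_dominant_x \<eta> \<alpha> L \<longleftrightarrow>
     (\<forall>z. mat \<alpha> \<preceq> hess_xx L z
            + hess_xy L z ** matrix_inv (mat \<eta> - hess_yy L z) ** hess_yx L z)"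

definition interaction_dominant_y ::
    "real \<Rightarrow> real \<Rightarrow> ((real ^ 'n) \<times> (real ^ 'm) \<Rightarrow> real) \<Rightarrow> bool" where
  "interaction_dominant_y \<eta> \<alpha> L \<longleftrightarrow>
     (\<forall>z. mat \<alpha> \<preceq> - hess_yy L z
            + hess_yx L z ** matrix_inv (mat \<eta> + hess_xx L z) ** hess_xy L z)"

text \<open>
  Attained extrema, rather than infima and suprema: both values are unspecified
  if the extremum is not attained.
\<close>

definition min_value :: "('a \<Rightarrow> real) \<Rightarrow> real" where
  "min_value f = (LEAST r. r \<in> range f)"

definition max_value :: "('a \<Rightarrow> real) \<Rightarrow> real" where
  "max_value f = (GREATEST r. r \<in> range f)"

definition saddle_envelope ::
    "real \<Rightarrow> ((real ^ 'n) \<times> (real ^ 'm) \<Rightarrow> real) \<Rightarrow> (real ^ 'n) \<times> (real ^ 'm) \<Rightarrow> real" where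
  "saddle_envelope \<eta> L = (\<lambda>(x, y). min_value (\<lambda>u. max_value (\<lambda>v.
     L (u, v) + \<eta> / 2 * (norm (u - x))\<^sup>2 - \<eta> / 2 * (norm (v - y))\<^sup>2)))"

end

theory Submission
  imports Defs
begin

text \<open>
  The saddle point \<open>prox z\<close> of the regularized problem solves
  \<open>G (prox z) = \<eta> z\<close> for \<open>G = \<eta> I + (\<nabla>\<^sub>x L, - \<nabla>\<^sub>y L)\<close>. Convexity-concavity makes
  \<open>G\<close> strongly monotone, hence injective with closed range; the range is also open by
  invariance of domain, so \<open>G\<close> is bijective, and its inverse is Lipschitz and differentiable.
  By the envelope formula \<open>\<nabla>L\<^sub>\<eta>(x, y) = (\<eta> (x - x'), \<eta> (y' - y))\<close> with
  \<open>(x', y') = prox (x, y)\<close>, and inverting the derivative of \<open>G\<close> by blocks gives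
  \<open>\<nabla>\<^sup>2\<^sub>x\<^sub>x L\<^sub>\<eta> = \<eta> I - \<eta>\<^sup>2 (\<eta> I + M)\<^sup>-\<^sup>1\<close> with \<open>M\<close> the interaction matrix
  at \<open>prox z\<close>, and symmetrically in \<open>y\<close>. Both bounds follow from \<open>M \<succeq> \<alpha> I\<close>.
\<close>

section \<open>Expanding maps: bijectivity and differentiability of the inverse\<close>

lemma strongly_monotone_imp_expanding:
  fixes f :: "'a::real_inner \<Rightarrow> 'a"
  assumes "\<And>z w. \<mu> * (norm (z - w))\<^sup>2 \<le> (f z - f w) \<bullet> (z - w)"
  shows "\<mu> * norm (z - w) \<le> norm (f z - f w)"
proof (cases "z = w")
  case False
  have "\<mu> * norm (z - w) * norm (z - w) \<le> (f z - f w) \<bullet> (z - w)"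
    using assms[of z w] by (simp add: power2_eq_square mult.assoc)
  also have "\<dots> \<le> norm (f z - f w) * norm (z - w)"
    by (rule norm_cauchy_schwarz)
  finally show ?thesis
    using False by simp
qed simp

lemma expanding_imp_inj:
  fixes f :: "'a::real_normed_vector \<Rightarrow> 'a"
  assumes "\<mu> > 0" and "\<And>z w. \<mu> * norm (z - w) \<le> norm (f z - f w)"
  shows "inj f"
proof (rule injI)
  fix z w assume "f z = f w"
  then show "z = w" 
    using assms(1) assms(2)[of z w] by (simp add: mult_le_0_iff)
qed

lemma expanding_imp_bij:
  fixes f :: "'a::euclidean_space \<Rightarrow> 'a"
  assumes \<mu>: "\<mu> > 0" and f: "\<And>z w. \<mu> * norm (z - w) \<le> norm (f z - f w)"
    and cont: "continuous_on UNIV f"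
  shows "bij f"
proof -
  have inj: "inj f"
    using \<mu> f by (rule expanding_imp_inj)
  have "open (range f)"
    using cont open_UNIV inj by (rule invariance_of_domain)
  moreover have "closed (range f)"
  proof (rule complete_imp_closed, rule completeI)
    fix s assume s: "\<forall>n. s n \<in> range f" and Cs: "Cauchy s"
    define t where "t n = inv f (s n)" for n
    have t: "s n = f (t n)" for n
      using s by (simp add: t_def f_inv_into_f)
    \<comment> \<open>Expansion bounds distances of preimages by \<open>1 / \<mu>\<close> times
      those of the images, so the Cauchy property passes back from \<open>s\<close> to
      \<open>t\<close>.\<close>
    have "Cauchy t"
    proof (rule CauchyI)
      fix e :: real assume "e > 0"
      then obtain M where M: "\<And>m n. M \<le> m \<Longrightarrow> M \<le> n \<Longrightarrow> norm (s m - s n) < \<mu> * e"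
        using CauchyD[OF Cs, of "\<mu> * e"] \<mu> by auto
      have "norm (t m - t n) < e" if "M \<le> m" "M \<le> n" for m n
        using f[of "t m" "t n"] M[OF that] \<mu> unfolding t
        by (meson le_less_trans mult_less_cancel_left_pos)
      then show "\<exists>M. \<forall>m\<ge>M. \<forall>n\<ge>M. norm (t m - t n) < e"
        by blast
    qed
    then obtain l where "t \<longlonglongrightarrow> l"
      using Cauchy_convergent convergent_def by blast
    then have "s \<longlonglongrightarrow> f l"
      unfolding t using cont by (auto simp: continuous_on_eq_continuous_at isCont_tendsto_compose)
    then show "\<exists>l\<in>range f. s \<longlonglongrightarrow> l"
      by blast
  qed
  \<comment> \<open>The whole space is connected, so a nonempty clopen set is everything.\<close>
  ultimately have "range f = UNIV"
    using clopen[of "range f"] by auto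
  with inj show ?thesis
    by (simp add: bij_def)
qed

text \<open>Along a kernel direction \<open>h\<close> the increment of \<open>f\<close> would be of
  smaller order than the step, whereas expansion forces it to be at least \<open>\<mu>\<close> times
  the length of the step.\<close>

lemma expanding_imp_inj_derivative:
  fixes f :: "'a::real_normed_vector \<Rightarrow> 'a"
  assumes \<mu>: "\<mu> > 0" and f: "\<And>z w. \<mu> * norm (z - w) \<le> norm (f z - f w)"
    and f': "(f has_derivative f') (at z)"
  shows "inj f'"
proof -
  interpret bounded_linear f'
    using f' by (rule has_derivative_bounded_linear)
  have "h = 0" if "f' h = 0" for h
  proof (rule ccontr)
    assume "h \<noteq> 0"
    obtain d where "d > 0" and d: "\<And>w. norm (w - z) < d \<Longrightarrow>
        norm (f w - f z - f' (w - z)) \<le> \<mu> / 2 * norm (w - z)"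
      using f' \<mu> unfolding has_derivative_at_alt by (meson half_gt_zero)
    \<comment> \<open>The step \<open>t h\<close> then has length \<open>d / 2\<close>, where the
      increment is at most half of what expansion demands.\<close>
    define t where "t = d / (2 * norm h)"
    have "t > 0" and "norm (t *\<^sub>R h) < d"
      using \<open>h \<noteq> 0\<close> \<open>d > 0\<close> by (auto simp: t_def)
    then have "norm (f (z + t *\<^sub>R h) - f z) \<le> \<mu> / 2 * norm (t *\<^sub>R h)"
      using d[of "z + t *\<^sub>R h"] that by (simp add: scaleR)
    moreover have "\<mu> * norm (t *\<^sub>R h) \<le> norm (f (z + t *\<^sub>R h) - f z)"
      using f[of "z + t *\<^sub>R h" z] by simp
    moreover have "\<mu> * norm (t *\<^sub>R h) > 0"
      using \<mu> \<open>t > 0\<close> \<open>h \<noteq> 0\<close> by simp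
    ultimately show False
      by linarith
  qed
  then show ?thesis
    by (simp add: linear_axioms linear_injective_0)
qed

text \<open>An inverse function theorem at one point, with no continuity of the derivative:
  expansion supplies the continuity of \<open>inv f\<close> and the injectivity of
  \<open>f'\<close>, and in finite dimension a left inverse of \<open>f'\<close> is also a right
  inverse.\<close>

lemma expanding_inv_has_derivative:
  fixes f :: "'a::euclidean_space \<Rightarrow> 'a"
  assumes \<mu>: "\<mu> > 0" and f: "\<And>z w. \<mu> * norm (z - w) \<le> norm (f z - f w)"
    and f': "(f has_derivative f') (at (inv f y))" and cont: "continuous_on UNIV f"
  obtains T where "(inv f has_derivative T) (at y)" and "f' \<circ> T = id"
proof -
  have bij: "bij f"
    using \<mu> f cont by (rule expanding_imp_bij)
  have inj: "inj f'"
    using \<mu> f f' by (rule expanding_imp_inj_derivative)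
  have lin: "linear f'"
    using f' by (rule has_derivative_linear)
  obtain T where T: "linear T" "T \<circ> f' = id"
    using linear_injective_left_inverse[OF lin inj] by blast
  have right_inv: "f (inv f z) = z" for z
    using bij by (simp add: bij_is_surj surj_f_inv_f)
  have "isCont (inv f) y"
  proof (unfold continuous_at_eps_delta, intro allI impI)
    fix e :: real assume "e > 0"
    have "dist (inv f w) (inv f y) < e" if "dist w y < \<mu> * e" for w
      using f[of "inv f w" "inv f y"] that \<mu>
      by (simp add: right_inv dist_norm) (meson le_less_trans mult_less_cancel_left_pos)
    then show "\<exists>d>0. \<forall>w. dist w y < d \<longrightarrow> dist (inv f w) (inv f y) < e"
      using \<mu> \<open>e > 0\<close> by (intro exI[of _ "\<mu> * e"]) auto
  qed
  then have "(inv f has_derivative T) (at y)"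
    using f' T right_inv
    by (intro has_derivative_inverse_basic[of f f' "inv f" y T UNIV]) (auto simp: linear_conv_bounded_linear)
  moreover have "f' \<circ> T = id"
    using linear_inverse_left[OF lin T(1)] T(2) by simp
  ultimately show thesis
    by (rule that)
qed

section \<open>Gradients and attained extreme values\<close>

lemma GDERIV_unique:
  assumes "GDERIV f z :> D" and "GDERIV f z :> E"
  shows "D = E"
proof -
  have "(\<lambda>h. h \<bullet> D) = (\<lambda>h. h \<bullet> E)"
    using assms unfolding gderiv_def by (rule has_derivative_unique)
  then show ?thesis
    by (simp add: fun_eq_iff vector_eq_ldot)
qed

lemma gradient_eqI:
  "GDERIV f z :> D \<Longrightarrow> gradient f z = D"
  unfolding gradient_def by (blast intro: GDERIV_unique)

lemma has_derivative_gradient: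
  fixes f :: "'a::euclidean_space \<Rightarrow> real"
  assumes "f differentiable (at z)"
  shows "(f has_derivative (\<lambda>h. h \<bullet> gradient f z)) (at z)"
proof -
  obtain f' where f': "(f has_derivative f') (at z)"
    using assms by (auto simp: differentiable_def)
  then have lin: "linear f'"
    by (rule has_derivative_linear)
  \<comment> \<open>Riesz representation: the vector representing a linear functional is its adjoint
    applied to \<open>1\<close>.\<close>
  have "f' = (\<lambda>h. h \<bullet> adjoint f' 1)"
    by (simp add: adjoint_works[OF lin] fun_eq_iff)
  then have "GDERIV f z :> adjoint f' 1"
    using f' by (simp add: gderiv_def)
  then show ?thesis
    by (simp add: gradient_eqI gderiv_def[symmetric])
qed

lemma min_value_eqI: "(\<And>u. f a \<le> f u) \<Longrightarrow> min_value f = f a"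
  unfolding min_value_def by (rule Least_equality) auto

lemma max_value_eqI: "(\<And>u. f u \<le> f a) \<Longrightarrow> max_value f = f a"
  unfolding max_value_def by (rule Greatest_equality) auto

section \<open>Symmetric matrices and the Loewner order\<close>

lemma scalar_matrix_vector_mult [simp]: "(mat c :: real ^ 'n ^ 'n) *v x = c *\<^sub>R x"
proof -
  have "(mat c :: real ^ 'n ^ 'n) = c *\<^sub>R mat 1"
    by (simp add: mat_def vec_eq_iff)
  then show ?thesis
    by (simp add: scaleR_matrix_vector_assoc[symmetric])
qed

lemma uminus_matrix_vector_mult: "(- A) *v x = - (A *v x)"
  for A :: "real ^ 'n ^ 'm"
  using matrix_vector_mult_diff_rdistrib[of 0 A x] by simp

text \<open>Lets the Loewner order be checked on vectors, without touching matrix entries.\<close>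

lemma symmetric_matrix_iff:
  fixes A :: "real ^ 'n ^ 'n"
  shows "transpose A = A \<longleftrightarrow> (\<forall>v w. (A *v v) \<bullet> w = v \<bullet> (A *v w))"
proof
  assume "transpose A = A"
  then show "\<forall>v w. (A *v v) \<bullet> w = v \<bullet> (A *v w)"
    by (metis dot_lmul_matrix vector_transpose_matrix)
next
  assume *: "\<forall>v w. (A *v v) \<bullet> w = v \<bullet> (A *v w)"
  have "transpose A *v w = A *v w" for w
  proof (subst vector_eq_rdot[symmetric], rule allI)
    fix v
    have "(transpose A *v w) \<bullet> v = w \<bullet> (A *v v)"
      by (simp only: vector_transpose_matrix[symmetric] transpose_transpose dot_lmul_matrix)
    with * show "(transpose A *v w) \<bullet> v = (A *v w) \<bullet> v"
      by simp
  qed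
  then show "transpose A = A"
    by (simp add: matrix_eq)
qed

lemma loewner_le_iff:
  "A \<preceq> B \<longleftrightarrow>
    (\<forall>v w. ((B - A) *v v) \<bullet> w = v \<bullet> ((B - A) *v w)) \<and> (\<forall>v. v \<bullet> (A *v v) \<le> v \<bullet> (B *v v))"
  unfolding loewner_le_def positive_semidefinite_def symmetric_matrix_iff
  by (simp add: matrix_vector_mult_diff_rdistrib inner_diff_right)

lemma scalar_loewner_leD:
  assumes "mat c \<preceq> A"
  shows "(A *v v) \<bullet> w = v \<bullet> (A *v w)" and "c * (norm v)\<^sup>2 \<le> v \<bullet> (A *v v)"
  using assms
  by (auto simp: loewner_le_iff matrix_vector_mult_diff_rdistrib inner_diff_left inner_diff_right
      power2_norm_eq_inner)

lemma scalar_loewner_leI: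
  assumes "\<And>v w. (A *v v) \<bullet> w = v \<bullet> (A *v w)" and "\<And>v. c * (norm v)\<^sup>2 \<le> v \<bullet> (A *v v)"
  shows "mat c \<preceq> A"
  using assms
  by (auto simp: loewner_le_iff matrix_vector_mult_diff_rdistrib inner_diff_left inner_diff_right
      power2_norm_eq_inner)

lemma loewner_le_scalarI:
  assumes "\<And>v w. (A *v v) \<bullet> w = v \<bullet> (A *v w)" and "\<And>v. v \<bullet> (A *v v) \<le> c * (norm v)\<^sup>2"
  shows "A \<preceq> mat c"
  using assms
  by (auto simp: loewner_le_iff matrix_vector_mult_diff_rdistrib inner_diff_left inner_diff_right
      power2_norm_eq_inner)

lemma matrix_inv_solves:
  fixes A :: "real ^ 'n ^ 'n"
  assumes "inj ((*v) A)" and "A *v q = r"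
  shows "matrix_inv A *v r = q"
proof -
  have "invertible A"
    using assms(1) by (simp add: invertible_left_inverse matrix_left_invertible_injective)
  \<comment> \<open>\<open>matrix_inv\<close> is a choice among two-sided inverses, so invertibility
    is what gives it meaning.\<close>
  then have "matrix_inv A ** A = mat 1"
    unfolding invertible_def matrix_inv_def by (rule someI2_ex) blast
  then show ?thesis
    using assms(2) by (metis matrix_vector_mul_assoc matrix_vector_mul_lid)
qed

lemma positive_definite_inj:
  fixes A :: "real ^ 'n ^ 'n"
  assumes "c > 0" and "\<And>v. c * (norm v)\<^sup>2 \<le> v \<bullet> (A *v v)"
  shows "inj ((*v) A)"
proof -
  have "v = 0" if "A *v v = 0" for v
    using assms(2)[of v] that \<open>c > 0\<close> by (simp add: mult_le_0_iff)
  then show ?thesis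
    by (simp add: linear_injective_0)
qed

text \<open>Here \<open>p\<close> is the inverse of \<open>\<eta> I + M\<close>, known only through
  the equation it solves. As \<open>\<eta> I + M\<close> is at least
  \<open>(\<eta> + \<alpha>) I\<close>, the form \<open>v \<bullet> p v\<close> lies between
  \<open>0\<close> and \<open>(norm v)^2 / (\<eta> + \<alpha>)\<close>; multiplying by
  \<open>\<eta>^2\<close> and subtracting from \<open>\<eta> (norm v)^2\<close> gives both bounds,
  because \<open>\<eta> - \<eta>^2 / (\<eta> + \<alpha>) = \<eta> \<alpha> / (\<eta> +
  \<alpha>)\<close>.\<close>

lemma loewner_bounds_inverse:
  fixes H M :: "real ^ 'n ^ 'n"
  assumes "\<eta> > 0" and "\<eta> + \<alpha> > 0" and M: "mat \<alpha> \<preceq> M"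
    and H: "\<And>h. H *v h = \<eta> *\<^sub>R h - \<eta>\<^sup>2 *\<^sub>R p h"
    and p: "\<And>h. \<eta> *\<^sub>R p h + M *v p h = h"
  shows "mat (\<eta> * \<alpha> / (\<eta> + \<alpha>)) \<preceq> H" and "H \<preceq> mat \<eta>"
proof -
  have sym: "(H *v v) \<bullet> w = v \<bullet> (H *v w)" for v w
  proof -
    \<comment> \<open>Writing \<open>w\<close> as the image of \<open>p w\<close> transfers the
      symmetry of \<open>M\<close> to \<open>p\<close>.\<close>
    have "p v \<bullet> w = p v \<bullet> (\<eta> *\<^sub>R p w + M *v p w)"
      by (simp only: p)
    also have "\<dots> = (\<eta> *\<^sub>R p v + M *v p v) \<bullet> p w"
      using scalar_loewner_leD(1)[OF M] by (simp add: inner_add_left inner_add_right)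
    finally have "p v \<bullet> w = v \<bullet> p w"
      by (simp only: p)
    then show ?thesis
      by (simp add: H inner_diff_left inner_diff_right)
  qed
  have coercive: "(\<eta> + \<alpha>) * (norm (p v))\<^sup>2 \<le> v \<bullet> p v" for v
  proof -
    have "v \<bullet> p v = (\<eta> *\<^sub>R p v + M *v p v) \<bullet> p v"
      by (simp only: p)
    also have "\<dots> = \<eta> * (norm (p v))\<^sup>2 + p v \<bullet> (M *v p v)"
      by (simp add: inner_add_left power2_norm_eq_inner inner_commute[of "M *v p v"])
    finally show ?thesis
      using scalar_loewner_leD(2)[OF M, of "p v"] by (simp add: distrib_right)
  qed
  have lower: "0 \<le> v \<bullet> p v" for v
    using coercive[of v] \<open>\<eta> + \<alpha> > 0\<close>
    by (meson less_imp_le mult_nonneg_nonneg order_trans zero_le_power2)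
  have upper: "v \<bullet> p v \<le> (norm v)\<^sup>2 / (\<eta> + \<alpha>)" for v
  proof -
    \<comment> \<open>Expanding this square and bounding its last term by \<open>coercive\<close>
      leaves the claim.\<close>
    have "0 \<le> (norm (v - (\<eta> + \<alpha>) *\<^sub>R p v))\<^sup>2"
      by simp
    also have "\<dots> = (norm v)\<^sup>2 - 2 * (\<eta> + \<alpha>) * (v \<bullet> p v) + (\<eta> + \<alpha>) * ((\<eta> + \<alpha>) * (norm (p v))\<^sup>2)"
      unfolding power2_norm_eq_inner
      by (simp add: algebra_simps inner_diff_left inner_diff_right inner_commute)
    also have "\<dots> \<le> (norm v)\<^sup>2 - 2 * (\<eta> + \<alpha>) * (v \<bullet> p v) + (\<eta> + \<alpha>) * (v \<bullet> p v)"
      using coercive[of v] \<open>\<eta> + \<alpha> > 0\<close> by simp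
    finally show ?thesis
      using \<open>\<eta> + \<alpha> > 0\<close> by (simp add: field_simps)
  qed
  have quad: "v \<bullet> (H *v v) = \<eta> * (norm v)\<^sup>2 - \<eta>\<^sup>2 * (v \<bullet> p v)" for v
    by (simp add: H inner_diff_right power2_norm_eq_inner)
  show "H \<preceq> mat \<eta>"
    using sym lower by (intro loewner_le_scalarI) (auto simp: quad)
  have "\<eta> * \<alpha> / (\<eta> + \<alpha>) * (norm v)\<^sup>2 \<le> v \<bullet> (H *v v)" for v
  proof -
    have "\<eta> * \<alpha> / (\<eta> + \<alpha>) * (norm v)\<^sup>2 = \<eta> * (norm v)\<^sup>2 - \<eta>\<^sup>2 * ((norm v)\<^sup>2 / (\<eta> + \<alpha>))"
      using \<open>\<eta> + \<alpha> > 0\<close> by (simp add: field_simps power2_eq_square)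
    also have "\<dots> \<le> v \<bullet> (H *v v)"
      using mult_left_mono[OF upper[of v], of "\<eta>\<^sup>2"] by (simp add: quad)
    finally show ?thesis .
  qed
  with sym show "mat (\<eta> * \<alpha> / (\<eta> + \<alpha>)) \<preceq> H"
    by (rule scalar_loewner_leI)
qed

section \<open>Taylor formula and Hessian blocks\<close>

text \<open>The Lagrange remainder on a line asks only that the second derivative exist, so no
  continuity of the Hessian enters.\<close>

lemma Taylor_second_order:
  fixes f :: "'a::euclidean_space \<Rightarrow> real"
  assumes "twice_differentiable f"
  obtains t where "f (z + d) = f z + d \<bullet> gradient f z
    + (d \<bullet> frechet_derivative (gradient f) (at (z + t *\<^sub>R d)) d) / 2"
proof -
  \<comment> \<open>For \<open>m\<close> up to 2 this is the \<open>m\<close>-th derivative of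
    \<open>f\<close> along the line, in the shape that \<open>Maclaurin\<close> expects.\<close>
  define D where "D m t = (if m = 0 then f (z + t *\<^sub>R d) else
    if m = 1 then d \<bullet> gradient f (z + t *\<^sub>R d)
    else d \<bullet> frechet_derivative (gradient f) (at (z + t *\<^sub>R d)) d)" for m :: nat and t :: real
  have line: "((\<lambda>t. z + t *\<^sub>R d) has_derivative (\<lambda>s. s *\<^sub>R d)) (at t)" for t
    by (auto intro!: derivative_eq_intros)
  have D0: "(D 0 has_real_derivative D 1 t) (at t)" for t
  proof -
    have "(f has_derivative (\<lambda>h. h \<bullet> gradient f (z + t *\<^sub>R d))) (at (z + t *\<^sub>R d))"
      using assms by (intro has_derivative_gradient) (simp add: twice_differentiable_def)
    from has_derivative_compose[OF line this] show ?thesis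
      by (simp add: D_def[abs_def] has_field_derivative_def mult_commute_abs)
  qed
  have D1: "(D 1 has_real_derivative D 2 t) (at t)" for t
  proof -
    let ?H = "frechet_derivative (gradient f) (at (z + t *\<^sub>R d))"
    have H: "(gradient f has_derivative ?H) (at (z + t *\<^sub>R d))"
      using assms by (simp add: twice_differentiable_def frechet_derivative_works)
    have "((\<lambda>t. d \<bullet> gradient f (z + t *\<^sub>R d)) has_derivative (\<lambda>s. d \<bullet> ?H (s *\<^sub>R d))) (at t)"
      by (intro has_derivative_inner_right has_derivative_compose[OF line H])
    then show ?thesis
      by (simp add: D_def[abs_def] has_field_derivative_def mult_commute_abs
          linear_cmul[OF has_derivative_linear[OF H]])
  qed
  have "\<exists>t. 0 < t \<and> t < 1 \<and>
      D 0 1 = (\<Sum>m<2. D m 0 / fact m * 1 ^ m) + D 2 t / fact 2 * 1 ^ 2"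
    using D0 D1 by (intro Maclaurin) (auto simp: less_Suc_eq numeral_2_eq_2)
  then obtain t where "D 0 1 = (\<Sum>m<2. D m 0 / fact m * 1 ^ m) + D 2 t / fact 2 * 1 ^ 2"
    by blast
  then have "f (z + d) = f z + d \<bullet> gradient f z
      + (d \<bullet> frechet_derivative (gradient f) (at (z + t *\<^sub>R d)) d) / 2"
    by (simp add: D_def lessThan_Suc numeral_2_eq_2)
  then show thesis
    by (rule that)
qed

text \<open>Linearity makes the \<open>matrix\<close> in each block represent its map. The lemma
  serves both \<open>L\<close> and its envelope.\<close>

lemma hessian_blocks:
  fixes f :: "(real ^ 'n) \<times> (real ^ 'm) \<Rightarrow> real"
  assumes "linear (frechet_derivative (gradient f) (at z))"
  shows "frechet_derivative (gradient f) (at z) (p, q)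
    = (hess_xx f z *v p + hess_xy f z *v q, hess_yx f z *v p + hess_yy f z *v q)"
proof -
  let ?D = "frechet_derivative (gradient f) (at z)"
  have l: "linear (\<lambda>p. ?D (p, 0))" "linear (\<lambda>q. ?D (0, q))"
    using linear_compose[OF _ assms, unfolded o_def, of "\<lambda>p. (p, 0)"]
      linear_compose[OF _ assms, unfolded o_def, of "\<lambda>q. (0, q)"]
    by (auto simp: linear_iff)
  have "linear (\<lambda>p. fst (?D (p, 0)))" "linear (\<lambda>q. fst (?D (0, q)))"
    "linear (\<lambda>p. snd (?D (p, 0)))" "linear (\<lambda>q. snd (?D (0, q)))"
    using l by (auto simp: linear_iff)
  then have "?D (p, 0) + ?D (0, q)
      = (hess_xx f z *v p + hess_xy f z *v q, hess_yx f z *v p + hess_yy f z *v q)"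
    unfolding hess_xx_def hess_xy_def hess_yx_def hess_yy_def
    by (simp add: matrix_works prod_eq_iff linear_matrix_vector_mul_eq)
  then show ?thesis
    using linear_add[OF assms, of "(p, 0)" "(0, q)"] by simp
qed

section \<open>The saddle field and its strong monotonicity\<close>

locale weakly_convex_concave =
  fixes L :: "(real ^ 'n) \<times> (real ^ 'm) \<Rightarrow> real" and \<rho> \<eta> :: real
  assumes twice: "twice_differentiable L"
    and wcwc: "weakly_convex_weakly_concave \<rho> L"
    and \<eta>_gt_\<rho>: "\<eta> > \<rho>"
begin

lemma gradient_has_derivative:
  "(gradient L has_derivative frechet_derivative (gradient L) (at z)) (at z)"
  using twice unfolding twice_differentiable_def frechet_derivative_works by blast

lemma hess_apply:
  "frechet_derivative (gradient L) (at z) (p, q)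
    = (hess_xx L z *v p + hess_xy L z *v q, hess_yx L z *v p + hess_yy L z *v q)"
  using gradient_has_derivative by (intro hessian_blocks has_derivative_linear)

text \<open>Taylor in the \<open>x\<close> direction, with the remainder bounded below by the
  \<open>xx\<close> block; \<open>concave_y\<close> is the mirror image.\<close>

lemma convex_x:
  "L (u, v) + (u' - u) \<bullet> fst (gradient L (u, v)) - \<rho> / 2 * (norm (u' - u))\<^sup>2 \<le> L (u', v)"
proof -
  obtain t where t: "L ((u, v) + (u' - u, 0)) = L (u, v) + (u' - u, 0) \<bullet> gradient L (u, v)
    + ((u' - u, 0) \<bullet> frechet_derivative (gradient L) (at ((u, v) + t *\<^sub>R (u' - u, 0))) (u' - u, 0)) / 2"
    by (rule Taylor_second_order[OF twice])
  have "mat (- \<rho>) \<preceq> hess_xx L ((u, v) + t *\<^sub>R (u' - u, 0))"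
    using wcwc unfolding weakly_convex_weakly_concave_def by blast
  from scalar_loewner_leD(2)[OF this, of "u' - u"] t show ?thesis
    by (simp add: hess_apply inner_prod_def)
qed

lemma concave_y:
  "L (u, v') \<le> L (u, v) + (v' - v) \<bullet> snd (gradient L (u, v)) + \<rho> / 2 * (norm (v' - v))\<^sup>2"
proof -
  obtain t where t: "L ((u, v) + (0, v' - v)) = L (u, v) + (0, v' - v) \<bullet> gradient L (u, v)
    + ((0, v' - v) \<bullet> frechet_derivative (gradient L) (at ((u, v) + t *\<^sub>R (0, v' - v))) (0, v' - v)) / 2"
    by (rule Taylor_second_order[OF twice])
  have "mat (- \<rho>) \<preceq> - hess_yy L ((u, v) + t *\<^sub>R (0, v' - v))"
    using wcwc unfolding weakly_convex_weakly_concave_def by blast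
  from scalar_loewner_leD(2)[OF this, of "v' - v"] t show ?thesis
    by (simp add: hess_apply inner_prod_def uminus_matrix_vector_mult)
qed

text \<open>The map \<open>G\<close> of the overview. The sign flip in the second component turns
  concavity in \<open>y\<close> into monotonicity.\<close>

definition saddle_field :: "(real ^ 'n) \<times> (real ^ 'm) \<Rightarrow> (real ^ 'n) \<times> (real ^ 'm)" where
  "saddle_field w = \<eta> *\<^sub>R w + (fst (gradient L w), - snd (gradient L w))"

lemma saddle_field_strongly_monotone:
  "(\<eta> - \<rho>) * (norm (w' - w))\<^sup>2 \<le> (saddle_field w' - saddle_field w) \<bullet> (w' - w)"
proof -
  obtain u v u' v' where w: "w = (u, v)" "w' = (u', v')"
    by (meson surj_pair)
  \<comment> \<open>The four inequalities run along the sides of the rectangle with corners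
    \<open>w\<close>, \<open>(u', v)\<close>, \<open>w'\<close>, \<open>(u, v')\<close>. In their
    sum the values of \<open>L\<close> cancel, and only gradients at \<open>w\<close> and
    \<open>w'\<close> remain.\<close>
  have "- \<rho> * ((norm (u' - u))\<^sup>2 + (norm (v' - v))\<^sup>2)
      \<le> (u' - u) \<bullet> (fst (gradient L w') - fst (gradient L w))
        - (v' - v) \<bullet> (snd (gradient L w') - snd (gradient L w))"
    using convex_x[of u v u'] convex_x[of u' v' u] concave_y[of u v' v] concave_y[of u' v v']
      norm_minus_commute[of u u'] norm_minus_commute[of v v']
    by (simp add: w algebra_simps inner_diff_left inner_diff_right)
  moreover have "(norm (w' - w))\<^sup>2 = (norm (u' - u))\<^sup>2 + (norm (v' - v))\<^sup>2"
    by (simp add: w norm_prod_def)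
  moreover have "(saddle_field w' - saddle_field w) \<bullet> (w' - w) = \<eta> * (norm (w' - w))\<^sup>2
      + ((u' - u) \<bullet> (fst (gradient L w') - fst (gradient L w))
        - (v' - v) \<bullet> (snd (gradient L w') - snd (gradient L w)))"
    unfolding power2_norm_eq_inner
    by (simp add: w saddle_field_def inner_prod_def algebra_simps inner_diff_left inner_diff_right
        inner_add_left inner_add_right inner_commute)
  ultimately show ?thesis
    by (simp add: left_diff_distrib)
qed

lemma saddle_field_expanding:
  "(\<eta> - \<rho>) * norm (w' - w) \<le> norm (saddle_field w' - saddle_field w)"
  using saddle_field_strongly_monotone by (rule strongly_monotone_imp_expanding)

lemma saddle_field_has_derivative:
  "(saddle_field has_derivative (\<lambda>(p, q).
    (\<eta> *\<^sub>R p + (hess_xx L w *v p + hess_xy L w *v q),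
     \<eta> *\<^sub>R q - (hess_yx L w *v p + hess_yy L w *v q)))) (at w)"
proof -
  have "(saddle_field has_derivative (\<lambda>h. \<eta> *\<^sub>R h
      + (fst (frechet_derivative (gradient L) (at w) h),
         - snd (frechet_derivative (gradient L) (at w) h)))) (at w)"
    unfolding saddle_field_def[abs_def]
    by (auto intro!: derivative_eq_intros gradient_has_derivative)
  then show ?thesis
    by (rule has_derivative_eq_rhs) (auto simp: fun_eq_iff hess_apply)
qed

lemma continuous_saddle_field: "continuous_on UNIV saddle_field"
  using saddle_field_has_derivative
  by (meson continuous_at_imp_continuous_on has_derivative_continuous)

lemma saddle_field_bij: "bij saddle_field"
  using \<eta>_gt_\<rho> by (intro expanding_imp_bij[OF _ saddle_field_expanding continuous_saddle_field]) simp

text \<open>The right-hand side states stationarity in both variables of the regularized problem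
  centred at \<open>z\<close>.\<close>

lemma saddle_field_eq_iff:
  "saddle_field w = \<eta> *\<^sub>R z \<longleftrightarrow>
    fst (gradient L w) = \<eta> *\<^sub>R (fst z - fst w) \<and> snd (gradient L w) = \<eta> *\<^sub>R (snd w - snd z)"
  by (auto simp: saddle_field_def prod_eq_iff algebra_simps)

section \<open>Saddle points of the regularized problem\<close>

definition regularized :: "(real ^ 'n) \<times> (real ^ 'm) \<Rightarrow> (real ^ 'n) \<times> (real ^ 'm) \<Rightarrow> real" where
  "regularized z w =
    L w + \<eta> / 2 * (norm (fst w - fst z))\<^sup>2 - \<eta> / 2 * (norm (snd w - snd z))\<^sup>2"

text \<open>Since \<open>\<eta> > \<rho>\<close>, the quadratic term outweighs the failure of
  concavity, so a stationary point in \<open>v\<close> is a global maximum.\<close>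

lemma regularized_le:
  assumes "snd (gradient L (u, v)) = \<eta> *\<^sub>R (v - snd z)"
  shows "regularized z (u, v') \<le> regularized z (u, v)"
proof -
  \<comment> \<open>The penalty expanded about \<open>v\<close>; stationarity turns its cross term
    into the gradient term of \<open>concave_y\<close>.\<close>
  have "\<eta> * (norm (v' - snd z))\<^sup>2
      = \<eta> * (norm (v' - v))\<^sup>2 + 2 * ((v' - v) \<bullet> snd (gradient L (u, v))) + \<eta> * (norm (v - snd z))\<^sup>2"
    unfolding assms power2_norm_eq_inner
    by (simp add: algebra_simps inner_diff_left inner_diff_right inner_commute)
  moreover have "\<rho> * (norm (v' - v))\<^sup>2 \<le> \<eta> * (norm (v' - v))\<^sup>2"
    using \<eta>_gt_\<rho> by (simp add: mult_right_mono)
  ultimately show ?thesis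
    using concave_y[of u v' v] by (simp add: regularized_def field_simps)
qed

lemma regularized_ge:
  assumes "fst (gradient L (u, v)) = \<eta> *\<^sub>R (fst z - u)"
  shows "regularized z (u, v) \<le> regularized z (u', v)"
proof -
  have "\<eta> * (norm (u' - fst z))\<^sup>2
      = \<eta> * (norm (u' - u))\<^sup>2 - 2 * ((u' - u) \<bullet> fst (gradient L (u, v))) + \<eta> * (norm (u - fst z))\<^sup>2"
    unfolding assms power2_norm_eq_inner
    by (simp add: algebra_simps inner_diff_left inner_diff_right inner_commute)
  moreover have "\<rho> * (norm (u' - u))\<^sup>2 \<le> \<eta> * (norm (u' - u))\<^sup>2"
    using \<eta>_gt_\<rho> by (simp add: mult_right_mono)
  ultimately show ?thesis
    using convex_x[of u v u'] by (simp add: regularized_def field_simps)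
qed

text \<open>The inner maximum has to be attained for every \<open>u\<close>, as
  \<open>max_value\<close> is unspecified otherwise. The stationarity equation in \<open>v\<close>
  is solvable because \<open>g\<close>, the second component of the saddle field at fixed
  \<open>u\<close>, is again expanding.\<close>

lemma ex_regularized_max:
  obtains v where "\<And>v'. regularized z (u, v') \<le> regularized z (u, v)"
proof -
  define g where "g v = \<eta> *\<^sub>R v - snd (gradient L (u, v))" for v
  have "(\<eta> - \<rho>) * (norm (v' - v))\<^sup>2 \<le> (g v' - g v) \<bullet> (v' - v)" for v v'
    using saddle_field_strongly_monotone[of "(u, v')" "(u, v)"]
    by (simp add: g_def saddle_field_def inner_prod_def norm_prod_def)
  note expanding = strongly_monotone_imp_expanding[of _ g, OF this]
  have "continuous_on UNIV (\<lambda>v. snd (saddle_field (u, v)))"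
    by (intro continuous_on_snd continuous_on_compose2[OF continuous_saddle_field] continuous_intros) auto
  then have "continuous_on UNIV g"
    by (simp add: g_def[abs_def] saddle_field_def)
  then have "bij g"
    using expanding \<eta>_gt_\<rho> by (intro expanding_imp_bij[of "\<eta> - \<rho>" g]) simp_all
  then obtain v where "g v = \<eta> *\<^sub>R snd z"
    by (metis bij_pointE)
  then have "snd (gradient L (u, v)) = \<eta> *\<^sub>R (v - snd z)"
    by (simp add: g_def algebra_simps)
  then show thesis
    using regularized_le that by blast
qed

text \<open>With \<open>g\<close> the inner maximum, \<open>g u' \<ge> regularized z (u', v) \<ge>
  regularized z (u, v) = g u\<close>, so the outer minimum is attained at \<open>u\<close>.\<close>

lemma saddle_envelope_eq:
  assumes "saddle_field w = \<eta> *\<^sub>R z"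
  shows "saddle_envelope \<eta> L z = regularized z w"
proof -
  obtain u v where w: "w = (u, v)"
    by fastforce
  define g where "g u = max_value (\<lambda>v. regularized z (u, v))" for u
  have g_ge: "regularized z (u', v') \<le> g u'" for u' v'
  proof -
    obtain v0 where v0: "\<And>v'. regularized z (u', v') \<le> regularized z (u', v0)"
      using ex_regularized_max by blast
    then show ?thesis
      unfolding g_def using max_value_eqI[of "\<lambda>v. regularized z (u', v)" v0] by simp
  qed
  have grad: "fst (gradient L (u, v)) = \<eta> *\<^sub>R (fst z - u)"
      "snd (gradient L (u, v)) = \<eta> *\<^sub>R (v - snd z)"
    using assms by (simp_all add: w saddle_field_eq_iff)
  have g: "g u = regularized z (u, v)"
    unfolding g_def using regularized_le[OF grad(2)]
    by (rule max_value_eqI[of "\<lambda>v. regularized z (u, v)"])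
  have "g u \<le> g u'" for u'
    using regularized_ge[OF grad(1), of u'] g_ge[of u' v] g by linarith
  then have "min_value g = regularized z w"
    using min_value_eqI[of g u] g by (simp add: w)
  then show ?thesis
    by (simp add: saddle_envelope_def g_def[abs_def] regularized_def case_prod_beta)
qed

section \<open>The proximal map and its derivative\<close>

text \<open>For \<open>\<eta> > 0\<close> this is the resolvent of the monotone-type field in
  \<open>saddle_field\<close>: \<open>prox z\<close> is the \<open>w\<close> with
  \<open>w + F w / \<eta> = z\<close>, where \<open>F\<close> pairs the \<open>x\<close>-gradient
  with the negated \<open>y\<close>-gradient.\<close>

definition prox :: "(real ^ 'n) \<times> (real ^ 'm) \<Rightarrow> (real ^ 'n) \<times> (real ^ 'm)" where
  "prox z = inv saddle_field (\<eta> *\<^sub>R z)"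

lemma saddle_field_prox: "saddle_field (prox z) = \<eta> *\<^sub>R z"
  by (simp add: prox_def bij_is_surj saddle_field_bij surj_f_inv_f)

text \<open>\<open>T\<close> inverts the derivative of \<open>saddle_field\<close> at
  \<open>prox z\<close>, and the factor \<open>\<eta>\<close> comes from the chain rule. The inverse
  is exported as a block linear system, ready for elimination.\<close>

lemma prox_has_derivative:
  obtains T where "(prox has_derivative (\<lambda>h. \<eta> *\<^sub>R T h)) (at z)"
    and "\<And>h p q. T h = (p, q) \<Longrightarrow>
      \<eta> *\<^sub>R p + (hess_xx L (prox z) *v p + hess_xy L (prox z) *v q) = fst h \<and>
      \<eta> *\<^sub>R q - (hess_yx L (prox z) *v p + hess_yy L (prox z) *v q) = snd h"
proof -
  have "0 < \<eta> - \<rho>"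
    using \<eta>_gt_\<rho> by simp
  from expanding_inv_has_derivative[OF this saddle_field_expanding
      saddle_field_has_derivative continuous_saddle_field, of "\<eta> *\<^sub>R z", folded prox_def]
  obtain T where T: "(inv saddle_field has_derivative T) (at (\<eta> *\<^sub>R z))"
    and *: "(\<lambda>(p, q). (\<eta> *\<^sub>R p + (hess_xx L (prox z) *v p + hess_xy L (prox z) *v q),
     \<eta> *\<^sub>R q - (hess_yx L (prox z) *v p + hess_yy L (prox z) *v q))) \<circ> T = id" .
  show thesis
  proof (rule that)
    have "((\<lambda>z. \<eta> *\<^sub>R z) has_derivative (\<lambda>h. \<eta> *\<^sub>R h)) (at z)"
      by (auto intro!: derivative_eq_intros)
    from has_derivative_compose[OF this T] show "(prox has_derivative (\<lambda>h. \<eta> *\<^sub>R T h)) (at z)"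
      by (simp add: prox_def[abs_def] linear_cmul[OF has_derivative_linear[OF T]])
    show "\<eta> *\<^sub>R p + (hess_xx L (prox z) *v p + hess_xy L (prox z) *v q) = fst h \<and>
      \<eta> *\<^sub>R q - (hess_yx L (prox z) *v p + hess_yy L (prox z) *v q) = snd h" if "T h = (p, q)" for h p q
      using fun_cong[OF *, of h] that by (auto simp: prod_eq_iff)
  qed
qed

section \<open>First and second derivatives of the envelope\<close>

text \<open>Envelope formula: \<open>regularized z\<close> is stationary at \<open>prox z\<close>,
  so the terms containing the derivative \<open>P\<close> of \<open>prox\<close> cancel and only the
  explicit dependence on \<open>z\<close> contributes.\<close>

lemma saddle_envelope_GDERIV:
  "GDERIV (saddle_envelope \<eta> L) z :> (\<eta> *\<^sub>R (fst z - fst (prox z)), \<eta> *\<^sub>R (snd (prox z) - snd z))"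
proof -
  have env: "saddle_envelope \<eta> L = (\<lambda>z. regularized z (prox z))"
    using saddle_envelope_eq[OF saddle_field_prox] by blast
  obtain P where P: "(prox has_derivative P) (at z)"
    by (rule prox_has_derivative)
  have "(L has_derivative (\<lambda>h. h \<bullet> gradient L (prox z))) (at (prox z))"
    using twice unfolding twice_differentiable_def by (blast intro: has_derivative_gradient)
  note L = has_derivative_compose[OF P this]
  have grad: "gradient L (prox z) = (\<eta> *\<^sub>R (fst z - fst (prox z)), \<eta> *\<^sub>R (snd (prox z) - snd z))"
    using saddle_field_prox[of z] unfolding saddle_field_eq_iff by (simp add: prod_eq_iff)
  have "(saddle_envelope \<eta> L has_derivative (\<lambda>h. P h \<bullet> gradient L (prox z)
      + \<eta> * ((fst (P h) - fst h) \<bullet> (fst (prox z) - fst z))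
      - \<eta> * ((snd (P h) - snd h) \<bullet> (snd (prox z) - snd z)))) (at z)"
    unfolding env regularized_def power2_norm_eq_inner
    by (auto intro!: derivative_eq_intros L P simp: inner_commute)
  then show ?thesis
    unfolding gderiv_def
    by (rule has_derivative_eq_rhs)
      (simp add: grad fun_eq_iff inner_prod_def inner_diff_left inner_diff_right algebra_simps)
qed

lemma gradient_saddle_envelope:
  "gradient (saddle_envelope \<eta> L) =
    (\<lambda>z. (\<eta> *\<^sub>R (fst z - fst (prox z)), \<eta> *\<^sub>R (snd (prox z) - snd z)))"
  using gradient_eqI[OF saddle_envelope_GDERIV] by blast

lemma gradient_saddle_envelope_has_derivative:
  assumes "(prox has_derivative P) (at z)"
  shows "(gradient (saddle_envelope \<eta> L) has_derivative
    (\<lambda>h. (\<eta> *\<^sub>R (fst h - fst (P h)), \<eta> *\<^sub>R (snd (P h) - snd h)))) (at z)"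
  unfolding gradient_saddle_envelope
  by (intro has_derivative_Pair has_derivative_scaleR_right has_derivative_diff
      has_derivative_fst has_derivative_snd has_derivative_ident assms)

lemma twice_differentiable_saddle_envelope: "twice_differentiable (saddle_envelope \<eta> L)"
  unfolding twice_differentiable_def
proof (intro conjI allI)
  show "saddle_envelope \<eta> L differentiable at z" for z
    using saddle_envelope_GDERIV unfolding gderiv_def by (rule differentiableI)
  show "gradient (saddle_envelope \<eta> L) differentiable at z" for z
    by (rule prox_has_derivative[of z])
      (rule differentiableI[OF gradient_saddle_envelope_has_derivative])
qed

text \<open>One factor \<open>\<eta>\<close> stems from the gradient formula, the other from the
  derivative of \<open>prox\<close>. The sign in the \<open>yy\<close> case gives both blocks the
  shape required by \<open>loewner_bounds_inverse\<close>.\<close>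

lemma hess_saddle_envelope:
  assumes "(prox has_derivative (\<lambda>h. \<eta> *\<^sub>R T h)) (at z)"
  shows "hess_xx (saddle_envelope \<eta> L) z *v h = \<eta> *\<^sub>R h - \<eta>\<^sup>2 *\<^sub>R fst (T (h, 0))"
    and "- hess_yy (saddle_envelope \<eta> L) z *v k = \<eta> *\<^sub>R k - \<eta>\<^sup>2 *\<^sub>R snd (T (0, k))"
proof -
  let ?D = "frechet_derivative (gradient (saddle_envelope \<eta> L)) (at z)"
  note D = gradient_saddle_envelope_has_derivative[OF assms]
  have D_eq: "?D = (\<lambda>h. (\<eta> *\<^sub>R (fst h - \<eta> *\<^sub>R fst (T h)), \<eta> *\<^sub>R (\<eta> *\<^sub>R snd (T h) - snd h)))"
    using frechet_derivative_at[OF D] by simp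
  have "linear ?D"
    using has_derivative_linear[OF D] by (simp add: D_eq)
  from hessian_blocks[OF this, of h 0] hessian_blocks[OF this, of 0 k]
  have "hess_xx (saddle_envelope \<eta> L) z *v h = \<eta> *\<^sub>R h - \<eta>\<^sup>2 *\<^sub>R fst (T (h, 0))"
    and "hess_yy (saddle_envelope \<eta> L) z *v k = \<eta>\<^sup>2 *\<^sub>R snd (T (0, k)) - \<eta> *\<^sub>R k"
    by (auto simp: D_eq scaleR_diff_right power2_eq_square)
  then show "hess_xx (saddle_envelope \<eta> L) z *v h = \<eta> *\<^sub>R h - \<eta>\<^sup>2 *\<^sub>R fst (T (h, 0))"
    and "- hess_yy (saddle_envelope \<eta> L) z *v k = \<eta> *\<^sub>R k - \<eta>\<^sup>2 *\<^sub>R snd (T (0, k))"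
    by (simp_all add: uminus_matrix_vector_mult)
qed

section \<open>Bounds on the diagonal Hessian blocks of the envelope\<close>

text \<open>Ensures that \<open>matrix_inv\<close> in the interaction matrix is a true inverse: weak
  concavity makes the shifted block positive definite with constant
  \<open>\<eta> - \<rho>\<close>.\<close>

lemma inj_shifted_hess_yy: "inj ((*v) (mat \<eta> - hess_yy L w))"
proof (rule positive_definite_inj)
  show "0 < \<eta> - \<rho>"
    using \<eta>_gt_\<rho> by simp
  have "mat (- \<rho>) \<preceq> - hess_yy L w"
    using wcwc unfolding weakly_convex_weakly_concave_def by blast
  from scalar_loewner_leD(2)[OF this]
  show "(\<eta> - \<rho>) * (norm v)\<^sup>2 \<le> v \<bullet> ((mat \<eta> - hess_yy L w) *v v)" for v
    by (simp add: uminus_matrix_vector_mult matrix_vector_mult_diff_rdistrib inner_diff_right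
        power2_norm_eq_inner left_diff_distrib)
qed

lemma inj_shifted_hess_xx: "inj ((*v) (mat \<eta> + hess_xx L w))"
proof (rule positive_definite_inj)
  show "0 < \<eta> - \<rho>"
    using \<eta>_gt_\<rho> by simp
  have "mat (- \<rho>) \<preceq> hess_xx L w"
    using wcwc unfolding weakly_convex_weakly_concave_def by blast
  from scalar_loewner_leD(2)[OF this]
  show "(\<eta> - \<rho>) * (norm v)\<^sup>2 \<le> v \<bullet> ((mat \<eta> + hess_xx L w) *v v)" for v
    by (simp add: matrix_vector_mult_add_rdistrib inner_add_right
        power2_norm_eq_inner left_diff_distrib)
qed

text \<open>
  Eliminating the other block of unknowns from the linear system for the derivative of
  \<open>prox\<close> leaves the Schur complement \<open>\<eta> I + M\<close>, where \<open>M\<close> is the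
  interaction matrix.
\<close>

lemma hess_xx_saddle_envelope_bounds:
  assumes "\<eta> > 0" and "\<alpha> > - \<eta>" and dom: "interaction_dominant_x \<eta> \<alpha> L"
  shows "mat (\<eta> * \<alpha> / (\<eta> + \<alpha>)) \<preceq> hess_xx (saddle_envelope \<eta> L) z"
    and "hess_xx (saddle_envelope \<eta> L) z \<preceq> mat \<eta>"
proof -
  obtain T where T: "(prox has_derivative (\<lambda>h. \<eta> *\<^sub>R T h)) (at z)"
    and sys: "\<And>h p q. T h = (p, q) \<Longrightarrow>
      \<eta> *\<^sub>R p + (hess_xx L (prox z) *v p + hess_xy L (prox z) *v q) = fst h \<and>
      \<eta> *\<^sub>R q - (hess_yx L (prox z) *v p + hess_yy L (prox z) *v q) = snd h"
    by (rule prox_has_derivative[of z]) (rule that)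
  let ?C = "matrix_inv (mat \<eta> - hess_yy L (prox z))"
  let ?M = "hess_xx L (prox z) + hess_xy L (prox z) ** ?C ** hess_yx L (prox z)"
  have M: "mat \<alpha> \<preceq> ?M"
    using dom unfolding interaction_dominant_x_def by blast
  \<comment> \<open>Thus \<open>fst (T (h, 0))\<close> plays the part of \<open>p h\<close> in
    \<open>loewner_bounds_inverse\<close>.\<close>
  have solve: "\<eta> *\<^sub>R fst (T (h, 0)) + ?M *v fst (T (h, 0)) = h" for h
  proof -
    obtain p q where pq: "T (h, 0) = (p, q)"
      by fastforce
    note * = sys[OF pq, simplified]
    have "(mat \<eta> - hess_yy L (prox z)) *v q = hess_yx L (prox z) *v p"
      using * by (simp add: matrix_vector_mult_diff_rdistrib algebra_simps)
    then have "?C *v (hess_yx L (prox z) *v p) = q"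
      by (rule matrix_inv_solves[OF inj_shifted_hess_yy])
    with * show ?thesis
      by (simp add: pq matrix_vector_mult_add_rdistrib matrix_vector_mul_assoc[symmetric])
  qed
  have "\<eta> + \<alpha> > 0"
    using \<open>\<alpha> > - \<eta>\<close> by simp
  from loewner_bounds_inverse[OF \<open>\<eta> > 0\<close> this M hess_saddle_envelope(1)[OF T] solve]
  show "mat (\<eta> * \<alpha> / (\<eta> + \<alpha>)) \<preceq> hess_xx (saddle_envelope \<eta> L) z"
    and "hess_xx (saddle_envelope \<eta> L) z \<preceq> mat \<eta>" .
qed

lemma hess_yy_saddle_envelope_bounds:
  assumes "\<eta> > 0" and "\<alpha> > - \<eta>" and dom: "interaction_dominant_y \<eta> \<alpha> L"
  shows "mat (\<eta> * \<alpha> / (\<eta> + \<alpha>)) \<preceq> - hess_yy (saddle_envelope \<eta> L) z"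
    and "- hess_yy (saddle_envelope \<eta> L) z \<preceq> mat \<eta>"
proof -
  obtain T where T: "(prox has_derivative (\<lambda>h. \<eta> *\<^sub>R T h)) (at z)"
    and sys: "\<And>h p q. T h = (p, q) \<Longrightarrow>
      \<eta> *\<^sub>R p + (hess_xx L (prox z) *v p + hess_xy L (prox z) *v q) = fst h \<and>
      \<eta> *\<^sub>R q - (hess_yx L (prox z) *v p + hess_yy L (prox z) *v q) = snd h"
    by (rule prox_has_derivative[of z]) (rule that)
  let ?C = "matrix_inv (mat \<eta> + hess_xx L (prox z))"
  let ?M = "- hess_yy L (prox z) + hess_yx L (prox z) ** ?C ** hess_xy L (prox z)"
  have M: "mat \<alpha> \<preceq> ?M"
    using dom unfolding interaction_dominant_y_def by blast
  have solve: "\<eta> *\<^sub>R snd (T (0, k)) + ?M *v snd (T (0, k)) = k" for k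
  proof -
    obtain p q where pq: "T (0, k) = (p, q)"
      by fastforce
    note * = sys[OF pq, simplified]
    have "(mat \<eta> + hess_xx L (prox z)) *v p + hess_xy L (prox z) *v q = 0"
      using * by (simp add: matrix_vector_mult_add_rdistrib add.assoc)
    \<comment> \<open>The first row is solved for \<open>- p\<close>; together with the minus sign
      before the \<open>yx\<close> block in the second row this yields the plus sign in
      \<open>?M\<close>.\<close>
    then have "(mat \<eta> + hess_xx L (prox z)) *v (- p) = hess_xy L (prox z) *v q"
      by (simp add: linear_neg[OF matrix_vector_mul_linear] neg_eq_iff_add_eq_0)
    then have "?C *v (hess_xy L (prox z) *v q) = - p"
      by (rule matrix_inv_solves[OF inj_shifted_hess_xx])
    with * show ?thesis
      by (simp add: pq uminus_matrix_vector_mult matrix_vector_mult_add_rdistrib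
          matrix_vector_mul_assoc[symmetric] linear_neg[OF matrix_vector_mul_linear] algebra_simps)
  qed
  have "\<eta> + \<alpha> > 0"
    using \<open>\<alpha> > - \<eta>\<close> by simp
  from loewner_bounds_inverse[OF \<open>\<eta> > 0\<close> this M hess_saddle_envelope(2)[OF T] solve]
  show "mat (\<eta> * \<alpha> / (\<eta> + \<alpha>)) \<preceq> - hess_yy (saddle_envelope \<eta> L) z"
    and "- hess_yy (saddle_envelope \<eta> L) z \<preceq> mat \<eta>" .
qed

end

theorem proposition2p6:
  fixes L :: "(real ^ 'n) \<times> (real ^ 'm) \<Rightarrow> real"
    and \<rho> \<eta> \<alpha> :: real
  assumes "twice_differentiable L"
    and "weakly_convex_weakly_concave \<rho> L"
    and "\<eta> > 0" and "\<eta> > \<rho>"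
    and "\<alpha> > - \<eta>"
  shows "(interaction_dominant_x \<eta> \<alpha> L \<longrightarrow>
            twice_differentiable (saddle_envelope \<eta> L) \<and>
            (\<forall>z. mat (\<eta> * \<alpha> / (\<eta> + \<alpha>)) \<preceq> hess_xx (saddle_envelope \<eta> L) z \<and>
                 hess_xx (saddle_envelope \<eta> L) z \<preceq> mat \<eta>)) \<and>
         (interaction_dominant_y \<eta> \<alpha> L \<longrightarrow>
            twice_differentiable (saddle_envelope \<eta> L) \<and>
            (\<forall>z. mat (\<eta> * \<alpha> / (\<eta> + \<alpha>)) \<preceq> - hess_yy (saddle_envelope \<eta> L) z \<and>
                 - hess_yy (saddle_envelope \<eta> L) z \<preceq> mat \<eta>))"
proof -
  interpret weakly_convex_concave L \<rho> \<eta>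
    using assms by unfold_locales
  show ?thesis
    using twice_differentiable_saddle_envelope hess_xx_saddle_envelope_bounds
      hess_yy_saddle_envelope_bounds assms by blast
qed

end
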